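(* Let $u_k:\mathbf{R}_{>0}\to\mathbf{R}_{>0}$ be a family of functions, indexed by integers $k\ge 1$, satisfying $\liminf_{x\to\infty}u_k(x)>0$ for all $k$. Assume that $$\frac{z\,u_k(y)}{u_k(yz)}\longrightarrow 0\quad\text{as } z\to\infty,\ \text{uniformly in } y\ge 1 \text{ (real) and } k\ge 1 \text{ (integer)}.$$ Consider a locally bounded function $f:\mathbf{R}_{>0}\to\mathbf{R}_{>0}$ and positive constants $c_1,c_2,x_0$ such that for all integers $k\ge 1$ and all real $x\ge x_0$, $$f(x)\le u_k(x)+c_1k\,f(c_2x/k).$$ Then for some constants $A,x_1$ and some integer $k\ge 1$ we have $f(x)\le A\,u_k(x)$ for all $x\ge x_1$.
   Context: $\mathbf{R}_{>0}$ is the set of positive real numbers; locally bounded means bounded on every compact subset of $\mathbf{R}_{>0}$. *)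

theory Defs
  imports "HOL-Analysis.Analysis"
begin

definition locally_bounded_on :: "'a::topological_space set \<Rightarrow> ('a \<Rightarrow> 'b::metric_space) \<Rightarrow> bool" where
  "locally_bounded_on S f \<longleftrightarrow> (\<forall>K. compact K \<and> K \<subseteq> S \<longrightarrow> bounded (f ` K))"

end

theory Submission
  imports Defs
begin

text \<open>
  Fix \<open>k\<close> so large that, for \<open>z = k / c\<^sub>2\<close>, the uniform limit gives
  \<open>c\<^sub>1 k u\<^sub>k(x/z) \<le> u\<^sub>k(x) / 2\<close> for all \<open>x \<ge> z\<close>.  The recursive bound on \<open>f\<close> then propagates
  \<open>f \<le> A u\<^sub>k\<close> from \<open>x/z\<close> to \<open>x\<close> as soon as \<open>1 + A/2 \<le> A\<close>, so it suffices to have it on one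
  interval \<open>[x\<^sub>1, z x\<^sub>1]\<close>, where \<open>f\<close> is bounded and \<open>u\<^sub>k\<close> is bounded below.
\<close>

lemma scaling_induct [consumes 3, case_names base step]:
  fixes a x z :: real
  assumes "a > 0" "z > 1" "x \<ge> a"
    and base: "\<And>x. a \<le> x \<Longrightarrow> x \<le> a * z \<Longrightarrow> P x"
    and step: "\<And>x. a * z \<le> x \<Longrightarrow> P (x / z) \<Longrightarrow> P x"
  shows "P x"
proof -
  have *: "x \<ge> a \<Longrightarrow> x \<le> a * z ^ n \<Longrightarrow> P x" for n x
  proof (induction n arbitrary: x)
    case 0
    have "a \<le> a * z" using assms by simp
    with 0 show ?case by (intro base) auto
  next
    case (Suc n)
    show ?case
    proof (cases "x \<le> a * z")
      case True
      with Suc.prems show ?thesis by (intro base)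
    next
      case False
      then have "a \<le> x / z" "x / z \<le> a * z ^ n"
        using \<open>z > 1\<close> Suc.prems by (simp_all add: pos_le_divide_eq pos_divide_le_eq mult_ac)
      with False Suc.IH show ?thesis
        by (simp add: step)
    qed
  qed
  obtain n where "x / a < z ^ n"
    using real_arch_pow \<open>z > 1\<close> by blast
  then show ?thesis
    using \<open>x \<ge> a\<close> \<open>a > 0\<close> by (intro *[of x n]) (simp_all add: field_simps)
qed

lemma Liminf_at_top_pos_bounded_below:
  fixes g :: "real \<Rightarrow> real"
  assumes "Liminf at_top (\<lambda>x. ereal (g x)) > 0"
  obtains \<delta> X where "\<delta> > 0" "\<And>x. x \<ge> X \<Longrightarrow> g x \<ge> \<delta>"
proof -
  obtain \<delta> where "ereal 0 < ereal \<delta>" "ereal \<delta> < Liminf at_top (\<lambda>x. ereal (g x))"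
    using ereal_dense2[OF assms] by (auto simp: zero_ereal_def)
  from less_LiminfD[OF this(2)] obtain X where "\<And>x. x \<ge> X \<Longrightarrow> \<delta> < g x"
    by (auto simp: eventually_at_top_linorder)
  with \<open>ereal 0 < ereal \<delta>\<close> show thesis
    by (intro that[of \<delta> X]) (auto intro: less_imp_le)
qed

theorem lemma4p1:
  fixes u :: "nat \<Rightarrow> real \<Rightarrow> real" and f :: "real \<Rightarrow> real" and c\<^sub>1 c\<^sub>2 x\<^sub>0 :: real
  assumes u_pos: "\<And>k x. k \<ge> 1 \<Longrightarrow> x > 0 \<Longrightarrow> u k x > 0"
    and u_liminf: "\<And>k. k \<ge> 1 \<Longrightarrow> Liminf at_top (\<lambda>x. ereal (u k x)) > 0"
    and u_unif: "uniform_limit ({1..} \<times> {1..}) (\<lambda>z (y, k). z * u k y / u k (y * z)) (\<lambda>_. 0) at_top"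
    and f_pos: "\<And>x. x > 0 \<Longrightarrow> f x > 0"
    and f_bdd: "locally_bounded_on {0<..} f"
    and consts_pos: "c\<^sub>1 > 0" "c\<^sub>2 > 0" "x\<^sub>0 > 0"
    and f_le: "\<And>k x. k \<ge> 1 \<Longrightarrow> x \<ge> x\<^sub>0 \<Longrightarrow> f x \<le> u k x + c\<^sub>1 * real k * f (c\<^sub>2 * x / real k)"
  shows "\<exists>A x\<^sub>1 k. x\<^sub>1 > 0 \<and> k \<ge> 1 \<and> (\<forall>x\<ge>x\<^sub>1. f x \<le> A * u k x)"
proof -
  have "\<forall>\<^sub>F z in at_top. \<forall>p\<in>{1..} \<times> {1..}.
      dist (case p of (y, k) \<Rightarrow> z * u k y / u k (y * z)) 0 < 1 / (2 * c\<^sub>1 * c\<^sub>2)"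
    using uniform_limitD[OF u_unif] consts_pos by simp
  then obtain Z where "\<forall>z\<ge>Z. \<forall>p\<in>{1..} \<times> {1..}.
      dist (case p of (y, k) \<Rightarrow> z * u k y / u k (y * z)) 0 < 1 / (2 * c\<^sub>1 * c\<^sub>2)"
    unfolding eventually_at_top_linorder by blast
  then have Z: "z * u k y / u k (y * z) < 1 / (2 * c\<^sub>1 * c\<^sub>2)"
    if "z \<ge> Z" "y \<ge> 1" "k \<ge> 1" for z y k
  proof -
    have "(y, k) \<in> {1..} \<times> {1..}"
      using that by simp
    with \<open>\<forall>z\<ge>Z. _\<close> \<open>z \<ge> Z\<close>
    have "dist (case (y, k) of (y, k) \<Rightarrow> z * u k y / u k (y * z)) 0 < 1 / (2 * c\<^sub>1 * c\<^sub>2)"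
      by blast
    then show ?thesis
      by (simp only: prod.case dist_real_def)
  qed
  obtain k :: nat where k: "real k > max 1 Z * c\<^sub>2"
    using reals_Archimedean2 by blast
  define z where "z = real k / c\<^sub>2"
  have "z > max 1 Z"
    using k consts_pos by (simp only: z_def pos_less_divide_eq)
  then have z: "z > 1" "z \<ge> Z"
    by auto
  have k1: "k \<ge> 1"
    using z by (cases k) (auto simp: z_def)
  have contract: "c\<^sub>1 * real k * u k (x / z) \<le> u k x / 2" if "x \<ge> z" for x
  proof -
    have "z * u k (x / z) / u k x < 1 / (2 * c\<^sub>1 * c\<^sub>2)"
      using Z[of z "x / z" k] z k1 that by simp
    moreover have "u k x > 0"
      using u_pos k1 z that by simp
    ultimately show ?thesis
      using consts_pos by (simp add: z_def field_simps)
  qed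

  obtain \<delta> X where \<delta>: "\<delta> > 0" "\<And>x. x \<ge> X \<Longrightarrow> u k x \<ge> \<delta>"
    using Liminf_at_top_pos_bounded_below[OF u_liminf[OF k1]] by blast
  define x1 where "x1 = Max {1, x\<^sub>0, X}"
  have x1: "x1 \<ge> 1" "x1 \<ge> x\<^sub>0" "x1 \<ge> X"
    by (auto simp: x1_def)
  have "{x1..x1 * z} \<subseteq> {0<..}"
    using x1 by auto
  then have "bounded (f ` {x1..x1 * z})"
    using f_bdd compact_Icc unfolding locally_bounded_on_def by blast
  then obtain B where "\<forall>y\<in>f ` {x1..x1 * z}. norm y \<le> B"
    unfolding bounded_iff by blast
  then have B: "f x \<le> B" if "x1 \<le> x" "x \<le> x1 * z" for x
    using that by (simp add: abs_le_iff)
  define A where "A = max 2 (B / \<delta>)"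
  have A: "A \<ge> 2" "B \<le> A * \<delta>"
    using \<delta> by (auto simp: A_def max_def field_simps)

  have "f x \<le> A * u k x" if "x \<ge> x1" for x
  proof -
    have "x1 > 0" using x1 by simp
    from this z(1) that show ?thesis
    proof (induction rule: scaling_induct)
      case (base x)
      have "f x \<le> A * \<delta>"
        using B[OF base] A(2) by linarith
      also have "\<dots> \<le> A * u k x"
        using \<delta> base x1 A by (intro mult_left_mono) auto
      finally show ?case .
    next
      case (step x)
      have "x1 \<le> x1 * z" "z \<le> x1 * z"
        using x1 z by auto
      then have x: "x \<ge> z" "x \<ge> x\<^sub>0" "x > 0"
        using step.hyps x1 z by linarith+
      have "f x \<le> u k x + c\<^sub>1 * real k * f (x / z)"
        using f_le[OF k1 x(2)] by (simp add: z_def field_simps)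
      also have "\<dots> \<le> u k x + c\<^sub>1 * real k * (A * u k (x / z))"
        using step.IH consts_pos by (intro add_left_mono mult_left_mono) auto
      also have "\<dots> = u k x + A * (c\<^sub>1 * real k * u k (x / z))"
        by simp
      also have "\<dots> \<le> u k x + A * (u k x / 2)"
        using contract[OF x(1)] A by (intro add_left_mono mult_left_mono) auto
      also have "\<dots> = (1 + A / 2) * u k x"
        by (simp add: field_simps)
      also have "\<dots> \<le> A * u k x"
        using A u_pos[OF k1 x(3)] by (intro mult_right_mono) auto
      finally show ?case .
    qed
  qed
  with x1 k1 show ?thesis
    by (intro exI[of _ A] exI[of _ x1] exI[of _ k]) auto
qed

end
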